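(* Let $\mathcal C'$ and $\mathcal A'$ be the full subcategories of $\mathcal C$ and $\mathcal A$ on which the dual adjunction $P\dashv S$ restricts to a dual equivalence (i.e. the objects $X$ with $\eta^{\mathcal C}_X$ an isomorphism, resp. the objects $A$ with $\eta^{\mathcal A}_A$ an isomorphism). Suppose that $\mathcal C$ has $(\mathrm{RegEpi},\mathrm{Mono})$-factorisations for morphisms with domain in $\mathcal C'$; that $\mathcal C'$ is closed under regular epimorphic images (if $X\in\mathcal C'$ and $e\colon X\to Y$ is a regular epimorphism in $\mathcal C$, then $Y\in\mathcal C'$); that $S$ is faithful; and that $L$ preserves epimorphisms. Then for every $T$-coalgebra $(X,\gamma)$ with $X\in\mathcal C'$, logical equivalence, i.e. the kernel pair $(B,\pi,\pi')$ of the theory map $\mathrm{th}_\gamma\colon X\to S\Phi$, is a $\rho$-bisimulation on $(X,\gamma)$.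
   Context: $P\colon\mathcal C\to\mathcal A$, $S\colon\mathcal A\to\mathcal C$ are contravariant functors forming a dual adjunction (natural bijection $\mathcal C(X,SA)\cong\mathcal A(A,PX)$) with units $\eta^{\mathcal C}\colon\mathrm{Id}_{\mathcal C}\to SP$, $\eta^{\mathcal A}\colon\mathrm{Id}_{\mathcal A}\to PS$. $T\colon\mathcal C\to\mathcal C$ is an endofunctor; a $T$-coalgebra is $(X,\gamma)$ with $\gamma\colon X\to TX$. $(L,\rho)$ is a logic: $L\colon\mathcal A\to\mathcal A$, $\rho\colon LP\to PT$ natural; the complex algebra is $\gamma^*=P\gamma\circ\rho_X\colon LPX\to PX$. $L$ has an initial algebra $(\Phi,\alpha)$; the semantics $[\![-]\!]_\gamma\colon\Phi\to PX$ is the unique $L$-algebra morphism to $(PX,\gamma^* )$ and the theory map is $\mathrm{th}_\gamma=S[\![-]\!]_\gamma\circ\eta^{\mathcal C}_X$. Standing assumptions: $\mathcal C$ has pullbacks, and $\mathcal A$ has pullbacks or $\mathcal C$ has pushouts. A span $X_1\xleftarrow{\pi_1}B\xrightarrow{\pi_2}X_2$ is jointly mono if $\pi_1h=\pi_1h'$ and $\pi_2h=\pi_2h'$ imply $h=h'$; its dual span $(\bar B,\bar\pi_1,\bar\pi_2)$ is the pullback in $\mathcal A$ of $PX_1\xrightarrow{P\pi_1}PB\xleftarrow{P\pi_2}PX_2$; it is a $\rho$-bisimulation between $(X_1,\gamma_1)$ and $(X_2,\gamma_2)$ if $P\pi_1\circ\gamma_1^*\circ L\bar\pi_1=P\pi_2\circ\gamma_2^*\circ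 L\bar\pi_2$. *)

theory Defs
  imports Main
begin

section \<open>Categories\<close>

text \<open>
  A category is given by sets of objects and arrows inside arbitrary types; the composite
  \<open>g \<cdot>\<^bsub>C\<^esub> f\<close> (first \<open>f\<close>, then \<open>g\<close>) is only meaningful if \<open>Cod C f = Dom C g\<close>.
\<close>

record ('o, 'm) category =
  Obj :: "'o set"
  Arr :: "'m set"
  Dom :: "'m \<Rightarrow> 'o"
  Cod :: "'m \<Rightarrow> 'o"
  Ident :: "'o \<Rightarrow> 'm"
  Comp :: "'m \<Rightarrow> 'm \<Rightarrow> 'm" (infixr "\<cdot>\<index>" 70)

definition Hom :: "('o, 'm) category \<Rightarrow> 'o \<Rightarrow> 'o \<Rightarrow> 'm set" where
  "Hom C X Y = {f \<in> Arr C. Dom C f = X \<and> Cod C f = Y}"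

locale category =
  fixes C :: "('o, 'm) category"
  assumes Dom_Obj: "f \<in> Arr C \<Longrightarrow> Dom C f \<in> Obj C"
    and Cod_Obj: "f \<in> Arr C \<Longrightarrow> Cod C f \<in> Obj C"
    and Ident_Hom: "X \<in> Obj C \<Longrightarrow> Ident C X \<in> Hom C X X"
    and Comp_Hom: "f \<in> Hom C X Y \<Longrightarrow> g \<in> Hom C Y Z \<Longrightarrow> g \<cdot>\<^bsub>C\<^esub> f \<in> Hom C X Z"
    and Comp_Ident_left: "f \<in> Hom C X Y \<Longrightarrow> Ident C Y \<cdot>\<^bsub>C\<^esub> f = f"
    and Comp_Ident_right: "f \<in> Hom C X Y \<Longrightarrow> f \<cdot>\<^bsub>C\<^esub> Ident C X = f"
    and Comp_assoc:
      "f \<in> Hom C W X \<Longrightarrow> g \<in> Hom C X Y \<Longrightarrow> h \<in> Hom C Y Z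
        \<Longrightarrow> (h \<cdot>\<^bsub>C\<^esub> g) \<cdot>\<^bsub>C\<^esub> f = h \<cdot>\<^bsub>C\<^esub> (g \<cdot>\<^bsub>C\<^esub> f)"

definition full_subcategory :: "('o, 'm) category \<Rightarrow> 'o set \<Rightarrow> ('o, 'm) category" where
  "full_subcategory C U =
    C\<lparr>Obj := Obj C \<inter> U, Arr := {f \<in> Arr C. Dom C f \<in> U \<and> Cod C f \<in> U}\<rparr>"

definition is_iso :: "('o, 'm) category \<Rightarrow> 'm \<Rightarrow> bool" where
  "is_iso C f \<longleftrightarrow> f \<in> Arr C \<and>
    (\<exists>g \<in> Hom C (Cod C f) (Dom C f).
      g \<cdot>\<^bsub>C\<^esub> f = Ident C (Dom C f) \<and> f \<cdot>\<^bsub>C\<^esub> g = Ident C (Cod C f))"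

definition is_mono :: "('o, 'm) category \<Rightarrow> 'm \<Rightarrow> bool" where
  "is_mono C f \<longleftrightarrow> f \<in> Arr C \<and>
    (\<forall>W. \<forall>h \<in> Hom C W (Dom C f). \<forall>k \<in> Hom C W (Dom C f).
      f \<cdot>\<^bsub>C\<^esub> h = f \<cdot>\<^bsub>C\<^esub> k \<longrightarrow> h = k)"

definition is_epi :: "('o, 'm) category \<Rightarrow> 'm \<Rightarrow> bool" where
  "is_epi C f \<longleftrightarrow> f \<in> Arr C \<and>
    (\<forall>Z. \<forall>h \<in> Hom C (Cod C f) Z. \<forall>k \<in> Hom C (Cod C f) Z.
      h \<cdot>\<^bsub>C\<^esub> f = k \<cdot>\<^bsub>C\<^esub> f \<longrightarrow> h = k)"

definition is_coequaliser :: "('o, 'm) category \<Rightarrow> 'm \<Rightarrow> 'm \<Rightarrow> 'm \<Rightarrow> bool" where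
  "is_coequaliser C f g e \<longleftrightarrow> (\<exists>W X Y.
    f \<in> Hom C W X \<and> g \<in> Hom C W X \<and> e \<in> Hom C X Y \<and> e \<cdot>\<^bsub>C\<^esub> f = e \<cdot>\<^bsub>C\<^esub> g \<and>
    (\<forall>Z. \<forall>h \<in> Hom C X Z. h \<cdot>\<^bsub>C\<^esub> f = h \<cdot>\<^bsub>C\<^esub> g \<longrightarrow>
      (\<exists>!u. u \<in> Hom C Y Z \<and> u \<cdot>\<^bsub>C\<^esub> e = h)))"

definition is_regular_epi :: "('o, 'm) category \<Rightarrow> 'm \<Rightarrow> bool" where
  "is_regular_epi C e \<longleftrightarrow> (\<exists>f g. is_coequaliser C f g e)"

definition is_pullback ::
  "('o, 'm) category \<Rightarrow> 'm \<Rightarrow> 'm \<Rightarrow> 'o \<Rightarrow> 'm \<Rightarrow> 'm \<Rightarrow> bool" where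
  "is_pullback C f g B p q \<longleftrightarrow> (\<exists>X Y Z.
    f \<in> Hom C X Z \<and> g \<in> Hom C Y Z \<and> B \<in> Obj C \<and> p \<in> Hom C B X \<and> q \<in> Hom C B Y \<and>
    f \<cdot>\<^bsub>C\<^esub> p = g \<cdot>\<^bsub>C\<^esub> q \<and>
    (\<forall>W. \<forall>h \<in> Hom C W X. \<forall>k \<in> Hom C W Y. f \<cdot>\<^bsub>C\<^esub> h = g \<cdot>\<^bsub>C\<^esub> k \<longrightarrow>
      (\<exists>!u. u \<in> Hom C W B \<and> p \<cdot>\<^bsub>C\<^esub> u = h \<and> q \<cdot>\<^bsub>C\<^esub> u = k)))"

definition is_pushout ::
  "('o, 'm) category \<Rightarrow> 'm \<Rightarrow> 'm \<Rightarrow> 'o \<Rightarrow> 'm \<Rightarrow> 'm \<Rightarrow> bool" where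
  "is_pushout C f g Q i j \<longleftrightarrow> (\<exists>X Y Z.
    f \<in> Hom C Z X \<and> g \<in> Hom C Z Y \<and> Q \<in> Obj C \<and> i \<in> Hom C X Q \<and> j \<in> Hom C Y Q \<and>
    i \<cdot>\<^bsub>C\<^esub> f = j \<cdot>\<^bsub>C\<^esub> g \<and>
    (\<forall>W. \<forall>h \<in> Hom C X W. \<forall>k \<in> Hom C Y W. h \<cdot>\<^bsub>C\<^esub> f = k \<cdot>\<^bsub>C\<^esub> g \<longrightarrow>
      (\<exists>!u. u \<in> Hom C Q W \<and> u \<cdot>\<^bsub>C\<^esub> i = h \<and> u \<cdot>\<^bsub>C\<^esub> j = k)))"

definition has_pullbacks :: "('o, 'm) category \<Rightarrow> bool" where
  "has_pullbacks C \<longleftrightarrow>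
    (\<forall>f \<in> Arr C. \<forall>g \<in> Arr C. Cod C f = Cod C g \<longrightarrow> (\<exists>B p q. is_pullback C f g B p q))"

definition has_pushouts :: "('o, 'm) category \<Rightarrow> bool" where
  "has_pushouts C \<longleftrightarrow>
    (\<forall>f \<in> Arr C. \<forall>g \<in> Arr C. Dom C f = Dom C g \<longrightarrow> (\<exists>Q i j. is_pushout C f g Q i j))"

definition is_kernel_pair :: "('o, 'm) category \<Rightarrow> 'm \<Rightarrow> 'o \<Rightarrow> 'm \<Rightarrow> 'm \<Rightarrow> bool" where
  "is_kernel_pair C f B p q \<longleftrightarrow> is_pullback C f f B p q"

definition jointly_mono :: "('o, 'm) category \<Rightarrow> 'o \<Rightarrow> 'm \<Rightarrow> 'm \<Rightarrow> bool" where
  "jointly_mono C B p q \<longleftrightarrow>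
    (\<forall>W. \<forall>h \<in> Hom C W B. \<forall>k \<in> Hom C W B.
      p \<cdot>\<^bsub>C\<^esub> h = p \<cdot>\<^bsub>C\<^esub> k \<and> q \<cdot>\<^bsub>C\<^esub> h = q \<cdot>\<^bsub>C\<^esub> k \<longrightarrow> h = k)"

text \<open>
  Only the existence of factorisations is required: regular epimorphisms are orthogonal to
  monomorphisms in every category, so the diagonal fill-in property is automatic.
\<close>

definition has_RegEpi_Mono_factorisations_from ::
  "('o, 'm) category \<Rightarrow> 'o set \<Rightarrow> bool" where
  "has_RegEpi_Mono_factorisations_from C U \<longleftrightarrow>
    (\<forall>X \<in> U. \<forall>Y. \<forall>f \<in> Hom C X Y. \<exists>Z. \<exists>e \<in> Hom C X Z. \<exists>m \<in> Hom C Z Y.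
      is_regular_epi C e \<and> is_mono C m \<and> f = m \<cdot>\<^bsub>C\<^esub> e)"

definition closed_under_regular_epi_images :: "('o, 'm) category \<Rightarrow> 'o set \<Rightarrow> bool" where
  "closed_under_regular_epi_images C U \<longleftrightarrow>
    (\<forall>X \<in> U. \<forall>Y. \<forall>e \<in> Hom C X Y. is_regular_epi C e \<longrightarrow> Y \<in> U)"

section \<open>Functors\<close>

record ('o1, 'm1, 'o2, 'm2) functor_data =
  omap :: "'o1 \<Rightarrow> 'o2"
  amap :: "'m1 \<Rightarrow> 'm2"

locale covariant_functor = source: category C + target: category D
  for C :: "('o1, 'm1) category" and D :: "('o2, 'm2) category"
    and F :: "('o1, 'm1, 'o2, 'm2) functor_data" +
  assumes omap_Obj: "X \<in> Obj C \<Longrightarrow> omap F X \<in> Obj D"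
    and amap_Hom: "f \<in> Hom C X Y \<Longrightarrow> amap F f \<in> Hom D (omap F X) (omap F Y)"
    and amap_Ident: "X \<in> Obj C \<Longrightarrow> amap F (Ident C X) = Ident D (omap F X)"
    and amap_Comp: "f \<in> Hom C X Y \<Longrightarrow> g \<in> Hom C Y Z
      \<Longrightarrow> amap F (g \<cdot>\<^bsub>C\<^esub> f) = amap F g \<cdot>\<^bsub>D\<^esub> amap F f"

locale contravariant_functor = source: category C + target: category D
  for C :: "('o1, 'm1) category" and D :: "('o2, 'm2) category"
    and F :: "('o1, 'm1, 'o2, 'm2) functor_data" +
  assumes omap_Obj: "X \<in> Obj C \<Longrightarrow> omap F X \<in> Obj D"
    and amap_Hom: "f \<in> Hom C X Y \<Longrightarrow> amap F f \<in> Hom D (omap F Y) (omap F X)"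
    and amap_Ident: "X \<in> Obj C \<Longrightarrow> amap F (Ident C X) = Ident D (omap F X)"
    and amap_Comp: "f \<in> Hom C X Y \<Longrightarrow> g \<in> Hom C Y Z
      \<Longrightarrow> amap F (g \<cdot>\<^bsub>C\<^esub> f) = amap F f \<cdot>\<^bsub>D\<^esub> amap F g"

definition faithful :: "('o1, 'm1) category \<Rightarrow> ('o1, 'm1, 'o2, 'm2) functor_data \<Rightarrow> bool" where
  "faithful C F \<longleftrightarrow>
    (\<forall>X Y. \<forall>f \<in> Hom C X Y. \<forall>g \<in> Hom C X Y. amap F f = amap F g \<longrightarrow> f = g)"

definition preserves_epis :: "('o1, 'm1) category \<Rightarrow> ('o2, 'm2) category
    \<Rightarrow> ('o1, 'm1, 'o2, 'm2) functor_data \<Rightarrow> bool" where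
  "preserves_epis C D F \<longleftrightarrow> (\<forall>f. is_epi C f \<longrightarrow> is_epi D (amap F f))"

section \<open>Dual adjunctions\<close>

text \<open>
  \<open>\<phi> X Y\<close> is the bijection from \<open>C(X, S Y)\<close> to \<open>A(Y, P X)\<close>; \<open>transpose_natural\<close> is
  naturality in both variables at once.
\<close>

locale dual_adjunction =
  P: contravariant_functor C A P + S: contravariant_functor A C S
  for C :: "('co, 'cm) category" and A :: "('ao, 'am) category"
    and P :: "('co, 'cm, 'ao, 'am) functor_data"
    and S :: "('ao, 'am, 'co, 'cm) functor_data"
    and \<phi> :: "'co \<Rightarrow> 'ao \<Rightarrow> 'cm \<Rightarrow> 'am" +
  assumes transpose_bij: "X \<in> Obj C \<Longrightarrow> Y \<in> Obj A
      \<Longrightarrow> bij_betw (\<phi> X Y) (Hom C X (omap S Y)) (Hom A Y (omap P X))"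
    and transpose_natural: "h \<in> Hom C X' X \<Longrightarrow> a \<in> Hom A Y' Y \<Longrightarrow> f \<in> Hom C X (omap S Y)
      \<Longrightarrow> \<phi> X' Y' (amap S a \<cdot>\<^bsub>C\<^esub> f \<cdot>\<^bsub>C\<^esub> h) = amap P h \<cdot>\<^bsub>A\<^esub> \<phi> X Y f \<cdot>\<^bsub>A\<^esub> a"

text \<open>The units \<open>X \<rightarrow> S P X\<close> and \<open>Y \<rightarrow> P S Y\<close> are the transposes of identities.\<close>

definition unit_C :: "('co, 'cm) category \<Rightarrow> ('ao, 'am) category
    \<Rightarrow> ('co, 'cm, 'ao, 'am) functor_data \<Rightarrow> ('ao, 'am, 'co, 'cm) functor_data
    \<Rightarrow> ('co \<Rightarrow> 'ao \<Rightarrow> 'cm \<Rightarrow> 'am) \<Rightarrow> 'co \<Rightarrow> 'cm" where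
  "unit_C C A P S \<phi> X =
    inv_into (Hom C X (omap S (omap P X))) (\<phi> X (omap P X)) (Ident A (omap P X))"

definition unit_A :: "('co, 'cm) category
    \<Rightarrow> ('ao, 'am, 'co, 'cm) functor_data \<Rightarrow> ('co \<Rightarrow> 'ao \<Rightarrow> 'cm \<Rightarrow> 'am) \<Rightarrow> 'ao \<Rightarrow> 'am" where
  "unit_A C S \<phi> Y = \<phi> (omap S Y) Y (Ident C (omap S Y))"

text \<open>The full subcategories between which the adjunction restricts to a dual equivalence.\<close>

definition fixed_C :: "('co, 'cm) category \<Rightarrow> ('ao, 'am) category
    \<Rightarrow> ('co, 'cm, 'ao, 'am) functor_data \<Rightarrow> ('ao, 'am, 'co, 'cm) functor_data
    \<Rightarrow> ('co \<Rightarrow> 'ao \<Rightarrow> 'cm \<Rightarrow> 'am) \<Rightarrow> ('co, 'cm) category" where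
  "fixed_C C A P S \<phi> = full_subcategory C {X \<in> Obj C. is_iso C (unit_C C A P S \<phi> X)}"

definition fixed_A :: "('co, 'cm) category \<Rightarrow> ('ao, 'am) category
    \<Rightarrow> ('ao, 'am, 'co, 'cm) functor_data
    \<Rightarrow> ('co \<Rightarrow> 'ao \<Rightarrow> 'cm \<Rightarrow> 'am) \<Rightarrow> ('ao, 'am) category" where
  "fixed_A C A S \<phi> = full_subcategory A {Y \<in> Obj A. is_iso A (unit_A C S \<phi> Y)}"

section \<open>Coalgebras, algebras and logics\<close>

definition is_coalgebra :: "('o, 'm) category \<Rightarrow> ('o, 'm, 'o, 'm) functor_data
    \<Rightarrow> 'o \<Rightarrow> 'm \<Rightarrow> bool" where
  "is_coalgebra C T X \<gamma> \<longleftrightarrow> X \<in> Obj C \<and> \<gamma> \<in> Hom C X (omap T X)"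

definition is_algebra :: "('o, 'm) category \<Rightarrow> ('o, 'm, 'o, 'm) functor_data
    \<Rightarrow> 'o \<Rightarrow> 'm \<Rightarrow> bool" where
  "is_algebra A L Y a \<longleftrightarrow> Y \<in> Obj A \<and> a \<in> Hom A (omap L Y) Y"

definition is_algebra_morphism :: "('o, 'm) category \<Rightarrow> ('o, 'm, 'o, 'm) functor_data
    \<Rightarrow> 'o \<Rightarrow> 'm \<Rightarrow> 'o \<Rightarrow> 'm \<Rightarrow> 'm \<Rightarrow> bool" where
  "is_algebra_morphism A L Y a Z b h \<longleftrightarrow> h \<in> Hom A Y Z \<and> h \<cdot>\<^bsub>A\<^esub> a = b \<cdot>\<^bsub>A\<^esub> amap L h"

definition is_initial_algebra :: "('o, 'm) category \<Rightarrow> ('o, 'm, 'o, 'm) functor_data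
    \<Rightarrow> 'o \<Rightarrow> 'm \<Rightarrow> bool" where
  "is_initial_algebra A L \<Phi> \<alpha> \<longleftrightarrow> is_algebra A L \<Phi> \<alpha> \<and>
    (\<forall>Y a. is_algebra A L Y a \<longrightarrow> (\<exists>!h. is_algebra_morphism A L \<Phi> \<alpha> Y a h))"

text \<open>A logic \<open>(L, \<rho>)\<close> for \<open>T\<close>-coalgebras, with \<open>\<rho>\<close> a natural transformation from \<open>L P\<close> to \<open>P T\<close>.\<close>

locale coalgebraic_logic =
  dual_adjunction C A P S \<phi> + T: covariant_functor C C T + L: covariant_functor A A L
  for C :: "('co, 'cm) category" and A :: "('ao, 'am) category"
    and P :: "('co, 'cm, 'ao, 'am) functor_data"
    and S :: "('ao, 'am, 'co, 'cm) functor_data"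
    and \<phi> :: "'co \<Rightarrow> 'ao \<Rightarrow> 'cm \<Rightarrow> 'am"
    and T :: "('co, 'cm, 'co, 'cm) functor_data"
    and L :: "('ao, 'am, 'ao, 'am) functor_data"
    and \<rho> :: "'co \<Rightarrow> 'am" +
  assumes rho_Hom: "X \<in> Obj C \<Longrightarrow> \<rho> X \<in> Hom A (omap L (omap P X)) (omap P (omap T X))"
    and rho_natural: "f \<in> Hom C X Y
      \<Longrightarrow> \<rho> X \<cdot>\<^bsub>A\<^esub> amap L (amap P f) = amap P (amap T f) \<cdot>\<^bsub>A\<^esub> \<rho> Y"

definition complex_algebra :: "('ao, 'am) category \<Rightarrow> ('co, 'cm, 'ao, 'am) functor_data
    \<Rightarrow> ('co \<Rightarrow> 'am) \<Rightarrow> 'co \<Rightarrow> 'cm \<Rightarrow> 'am" where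
  "complex_algebra A P \<rho> X \<gamma> = amap P \<gamma> \<cdot>\<^bsub>A\<^esub> \<rho> X"

definition semantics :: "('ao, 'am) category \<Rightarrow> ('co, 'cm, 'ao, 'am) functor_data
    \<Rightarrow> ('ao, 'am, 'ao, 'am) functor_data \<Rightarrow> ('co \<Rightarrow> 'am) \<Rightarrow> 'ao \<Rightarrow> 'am
    \<Rightarrow> 'co \<Rightarrow> 'cm \<Rightarrow> 'am" where
  "semantics A P L \<rho> \<Phi> \<alpha> X \<gamma> =
    (THE h. is_algebra_morphism A L \<Phi> \<alpha> (omap P X) (complex_algebra A P \<rho> X \<gamma>) h)"

definition theory_map :: "('co, 'cm) category \<Rightarrow> ('ao, 'am) category
    \<Rightarrow> ('co, 'cm, 'ao, 'am) functor_data \<Rightarrow> ('ao, 'am, 'co, 'cm) functor_data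
    \<Rightarrow> ('co \<Rightarrow> 'ao \<Rightarrow> 'cm \<Rightarrow> 'am) \<Rightarrow> ('ao, 'am, 'ao, 'am) functor_data \<Rightarrow> ('co \<Rightarrow> 'am)
    \<Rightarrow> 'ao \<Rightarrow> 'am \<Rightarrow> 'co \<Rightarrow> 'cm \<Rightarrow> 'cm" where
  "theory_map C A P S \<phi> L \<rho> \<Phi> \<alpha> X \<gamma> =
    amap S (semantics A P L \<rho> \<Phi> \<alpha> X \<gamma>) \<cdot>\<^bsub>C\<^esub> unit_C C A P S \<phi> X"

definition is_dual_span :: "('ao, 'am) category \<Rightarrow> ('co, 'cm, 'ao, 'am) functor_data
    \<Rightarrow> 'cm \<Rightarrow> 'cm \<Rightarrow> 'ao \<Rightarrow> 'am \<Rightarrow> 'am \<Rightarrow> bool" where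
  "is_dual_span A P \<pi>\<^sub>1 \<pi>\<^sub>2 D d\<^sub>1 d\<^sub>2 \<longleftrightarrow> is_pullback A (amap P \<pi>\<^sub>1) (amap P \<pi>\<^sub>2) D d\<^sub>1 d\<^sub>2"

text \<open>
  The dual span is determined up to isomorphism only, and the equation below does not depend on
  its choice; quantifying existentially makes its existence part of the notion.
\<close>

definition is_rho_bisimulation :: "('co, 'cm) category \<Rightarrow> ('ao, 'am) category
    \<Rightarrow> ('co, 'cm, 'ao, 'am) functor_data \<Rightarrow> ('ao, 'am, 'ao, 'am) functor_data
    \<Rightarrow> ('co \<Rightarrow> 'am) \<Rightarrow> 'co \<Rightarrow> 'cm \<Rightarrow> 'co \<Rightarrow> 'cm \<Rightarrow> 'co \<Rightarrow> 'cm \<Rightarrow> 'cm \<Rightarrow> bool" where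
  "is_rho_bisimulation C A P L \<rho> X\<^sub>1 \<gamma>\<^sub>1 X\<^sub>2 \<gamma>\<^sub>2 B \<pi>\<^sub>1 \<pi>\<^sub>2 \<longleftrightarrow>
    B \<in> Obj C \<and> \<pi>\<^sub>1 \<in> Hom C B X\<^sub>1 \<and> \<pi>\<^sub>2 \<in> Hom C B X\<^sub>2 \<and> jointly_mono C B \<pi>\<^sub>1 \<pi>\<^sub>2 \<and>
    (\<exists>D d\<^sub>1 d\<^sub>2. is_dual_span A P \<pi>\<^sub>1 \<pi>\<^sub>2 D d\<^sub>1 d\<^sub>2 \<and>
      amap P \<pi>\<^sub>1 \<cdot>\<^bsub>A\<^esub> complex_algebra A P \<rho> X\<^sub>1 \<gamma>\<^sub>1 \<cdot>\<^bsub>A\<^esub> amap L d\<^sub>1 =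
      amap P \<pi>\<^sub>2 \<cdot>\<^bsub>A\<^esub> complex_algebra A P \<rho> X\<^sub>2 \<gamma>\<^sub>2 \<cdot>\<^bsub>A\<^esub> amap L d\<^sub>2)"

end

theory Submission
  imports Defs
begin

text \<open>
  Factorise the theory map as \<open>m \<cdot> e\<close> with \<open>e : X \<rightarrow> Z\<close> a regular epimorphism and \<open>m\<close> a
  monomorphism. Then \<open>e\<close> is the coequaliser of the kernel pair \<open>(B, \<pi>, \<pi>')\<close>, so \<open>P e\<close> is the
  equaliser of \<open>P \<pi>\<close> and \<open>P \<pi>'\<close>. Since \<open>\<pi>\<close> and \<open>\<pi>'\<close> have a common section, this equaliser,
  used twice, is also their pullback, so the dual span is \<open>(P Z, P e, P e)\<close>. The transpose
  \<open>n : \<Phi> \<rightarrow> P Z\<close> of \<open>m\<close> is an epimorphism: \<open>S n\<close> is \<open>m\<close> up to the isomorphism \<open>\<eta>\<^sub>Z\<close> and \<open>S\<close> is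
  faithful. Hence \<open>L n\<close> is an epimorphism, and the bisimulation equation may be checked after
  composing with \<open>L n\<close>, where it reduces to \<open>P e \<cdot> n\<close> being the semantics.
\<close>

section \<open>Endpoints of arrows and unpacked universal properties\<close>

lemma Hom_unique:
  assumes "f \<in> Hom C X Y" "f \<in> Hom C X' Y'"
  shows "X' = X" "Y' = Y"
  using assms unfolding Hom_def by auto

text \<open>The definition of a pullback quantifies its corner objects existentially. An arrow
  determines its domain and codomain, so the hidden corners coincide with the given \<open>X\<close>
  and \<open>Y\<close>.\<close>

lemma is_pullbackD:
  assumes "is_pullback C f g B p q" "f \<in> Hom C X Z" "g \<in> Hom C Y Z"
  shows "B \<in> Obj C" "p \<in> Hom C B X" "q \<in> Hom C B Y" "f \<cdot>\<^bsub>C\<^esub> p = g \<cdot>\<^bsub>C\<^esub> q"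
    and "\<lbrakk>h \<in> Hom C W X; k \<in> Hom C W Y; f \<cdot>\<^bsub>C\<^esub> h = g \<cdot>\<^bsub>C\<^esub> k\<rbrakk>
      \<Longrightarrow> \<exists>!u. u \<in> Hom C W B \<and> p \<cdot>\<^bsub>C\<^esub> u = h \<and> q \<cdot>\<^bsub>C\<^esub> u = k"
proof -
  obtain X' Y' Z' where *: "f \<in> Hom C X' Z'" "g \<in> Hom C Y' Z'" "B \<in> Obj C"
      "p \<in> Hom C B X'" "q \<in> Hom C B Y'" "f \<cdot>\<^bsub>C\<^esub> p = g \<cdot>\<^bsub>C\<^esub> q"
      "\<forall>W. \<forall>h \<in> Hom C W X'. \<forall>k \<in> Hom C W Y'. f \<cdot>\<^bsub>C\<^esub> h = g \<cdot>\<^bsub>C\<^esub> k \<longrightarrow>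
        (\<exists>!u. u \<in> Hom C W B \<and> p \<cdot>\<^bsub>C\<^esub> u = h \<and> q \<cdot>\<^bsub>C\<^esub> u = k)"
    using assms(1) unfolding is_pullback_def by blast
  have [simp]: "X' = X" "Y' = Y"
    using Hom_unique[OF assms(2) *(1)] Hom_unique[OF assms(3) *(2)] by auto
  show "B \<in> Obj C" "p \<in> Hom C B X" "q \<in> Hom C B Y" "f \<cdot>\<^bsub>C\<^esub> p = g \<cdot>\<^bsub>C\<^esub> q"
    using * by auto
  show "\<exists>!u. u \<in> Hom C W B \<and> p \<cdot>\<^bsub>C\<^esub> u = h \<and> q \<cdot>\<^bsub>C\<^esub> u = k"
    if "h \<in> Hom C W X" "k \<in> Hom C W Y" "f \<cdot>\<^bsub>C\<^esub> h = g \<cdot>\<^bsub>C\<^esub> k"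
    using that *(7) by simp
qed

lemma is_coequaliserD:
  assumes "is_coequaliser C f g e" "e \<in> Hom C X Y"
  shows "f \<in> Hom C (Dom C f) X" "g \<in> Hom C (Dom C f) X" "e \<cdot>\<^bsub>C\<^esub> f = e \<cdot>\<^bsub>C\<^esub> g"
    and "\<lbrakk>h \<in> Hom C X Z; h \<cdot>\<^bsub>C\<^esub> f = h \<cdot>\<^bsub>C\<^esub> g\<rbrakk> \<Longrightarrow> \<exists>!u. u \<in> Hom C Y Z \<and> u \<cdot>\<^bsub>C\<^esub> e = h"
proof -
  obtain W X' Y' where *: "f \<in> Hom C W X'" "g \<in> Hom C W X'" "e \<in> Hom C X' Y'"
      "e \<cdot>\<^bsub>C\<^esub> f = e \<cdot>\<^bsub>C\<^esub> g"
      "\<forall>Z. \<forall>h \<in> Hom C X' Z. h \<cdot>\<^bsub>C\<^esub> f = h \<cdot>\<^bsub>C\<^esub> g \<longrightarrow>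
        (\<exists>!u. u \<in> Hom C Y' Z \<and> u \<cdot>\<^bsub>C\<^esub> e = h)"
    using assms(1) unfolding is_coequaliser_def by blast
  have [simp]: "X' = X" "Y' = Y" using Hom_unique[OF assms(2) *(3)] by auto
  have "W = Dom C f" using *(1) unfolding Hom_def by simp
  then show "f \<in> Hom C (Dom C f) X" "g \<in> Hom C (Dom C f) X" "e \<cdot>\<^bsub>C\<^esub> f = e \<cdot>\<^bsub>C\<^esub> g"
    using * by auto
  show "\<exists>!u. u \<in> Hom C Y Z \<and> u \<cdot>\<^bsub>C\<^esub> e = h" if "h \<in> Hom C X Z" "h \<cdot>\<^bsub>C\<^esub> f = h \<cdot>\<^bsub>C\<^esub> g"
    using that *(5) by simp
qed

lemma is_epiD:
  assumes "is_epi C f" "f \<in> Hom C X Y" "h \<in> Hom C Y Z" "k \<in> Hom C Y Z" "h \<cdot>\<^bsub>C\<^esub> f = k \<cdot>\<^bsub>C\<^esub> f"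
  shows "h = k"
  using assms unfolding is_epi_def Hom_def by blast

lemma is_monoD:
  assumes "is_mono C f" "f \<in> Hom C X Y" "h \<in> Hom C W X" "k \<in> Hom C W X" "f \<cdot>\<^bsub>C\<^esub> h = f \<cdot>\<^bsub>C\<^esub> k"
  shows "h = k"
  using assms unfolding is_mono_def Hom_def by blast

section \<open>Kernel pairs, coequalisers and monomorphisms\<close>

context category
begin

lemma Hom_Obj:
  assumes "f \<in> Hom C X Y"
  shows "X \<in> Obj C" "Y \<in> Obj C"
  using assms Dom_Obj Cod_Obj unfolding Hom_def by auto

lemma pullback_jointly_mono:
  assumes pb: "is_pullback C f g B p q" and f: "f \<in> Hom C X Z" and g: "g \<in> Hom C Y Z"
  shows "jointly_mono C B p q"
  unfolding jointly_mono_def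
proof (intro allI ballI impI)
  fix W h k
  assume h: "h \<in> Hom C W B" and k: "k \<in> Hom C W B"
    and eq: "p \<cdot>\<^bsub>C\<^esub> h = p \<cdot>\<^bsub>C\<^esub> k \<and> q \<cdot>\<^bsub>C\<^esub> h = q \<cdot>\<^bsub>C\<^esub> k"
  note D = is_pullbackD[OF pb f g]
  have "f \<cdot>\<^bsub>C\<^esub> (p \<cdot>\<^bsub>C\<^esub> h) = g \<cdot>\<^bsub>C\<^esub> (q \<cdot>\<^bsub>C\<^esub> h)"
    using Comp_assoc[OF h D(2) f] Comp_assoc[OF h D(3) g] D(4) by simp
  from D(5)[OF Comp_Hom[OF h D(2)] Comp_Hom[OF h D(3)] this] show "h = k"
    using h k eq by metis
qed

text \<open>A monomorphism can be cancelled on the left, so \<open>e\<close> and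
  \<open>m \<cdot> e\<close> identify exactly the same pairs of arrows and have the same
  cones.\<close>

lemma kernel_pair_mono_comp:
  assumes kp: "is_kernel_pair C (m \<cdot>\<^bsub>C\<^esub> e) B p q"
    and e: "e \<in> Hom C X Z" and m: "m \<in> Hom C Z Y" and mono: "is_mono C m"
  shows "is_kernel_pair C e B p q"
proof -
  have me: "m \<cdot>\<^bsub>C\<^esub> e \<in> Hom C X Y" using Comp_Hom[OF e m] .
  note D = is_pullbackD[OF kp[unfolded is_kernel_pair_def] me me]
  have "m \<cdot>\<^bsub>C\<^esub> (e \<cdot>\<^bsub>C\<^esub> p) = m \<cdot>\<^bsub>C\<^esub> (e \<cdot>\<^bsub>C\<^esub> q)"
    using Comp_assoc[OF D(2) e m] Comp_assoc[OF D(3) e m] D(4) by simp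
  then have "e \<cdot>\<^bsub>C\<^esub> p = e \<cdot>\<^bsub>C\<^esub> q"
    by (rule is_monoD[OF mono m Comp_Hom[OF D(2) e] Comp_Hom[OF D(3) e]])
  moreover have "\<exists>!u. u \<in> Hom C W B \<and> p \<cdot>\<^bsub>C\<^esub> u = h \<and> q \<cdot>\<^bsub>C\<^esub> u = k"
    if h: "h \<in> Hom C W X" and k: "k \<in> Hom C W X" and eq: "e \<cdot>\<^bsub>C\<^esub> h = e \<cdot>\<^bsub>C\<^esub> k" for W h k
    using D(5)[OF h k] Comp_assoc[OF h e m] Comp_assoc[OF k e m] eq by simp
  ultimately show ?thesis
    unfolding is_kernel_pair_def is_pullback_def using e D(1-3) by blast
qed

text \<open>Two copies of the identity form a cone over \<open>f\<close>, \<open>f\<close>; the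
  mediating arrow \<open>s\<close> is the diagonal.\<close>

lemma kernel_pair_section:
  assumes kp: "is_kernel_pair C f B p q" and f: "f \<in> Hom C X Y"
  obtains s where "s \<in> Hom C X B" "p \<cdot>\<^bsub>C\<^esub> s = Ident C X" "q \<cdot>\<^bsub>C\<^esub> s = Ident C X"
  using is_pullbackD(5)[OF kp[unfolded is_kernel_pair_def] f f, of "Ident C X" X "Ident C X"]
    Ident_Hom[OF Hom_Obj(1)[OF f]] by blast

text \<open>If \<open>e\<close> coequalises \<open>f\<close> and \<open>g\<close>, these factor
  through the kernel pair by one arrow \<open>v\<close>. Every \<open>h\<close> that identifies
  \<open>p\<close> and \<open>q\<close> then identifies \<open>f\<close> and \<open>g\<close>, and
  so factors uniquely through \<open>e\<close>.\<close>

lemma regular_epi_coequaliser_of_kernel_pair: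
  assumes re: "is_regular_epi C e" and e: "e \<in> Hom C X Y" and kp: "is_kernel_pair C e B p q"
  shows "is_coequaliser C p q e"
proof -
  note D = is_pullbackD[OF kp[unfolded is_kernel_pair_def] e e]
  obtain f g where co: "is_coequaliser C f g e" using re unfolding is_regular_epi_def by blast
  note E = is_coequaliserD[OF co e]
  obtain v where v: "v \<in> Hom C (Dom C f) B" "p \<cdot>\<^bsub>C\<^esub> v = f" "q \<cdot>\<^bsub>C\<^esub> v = g"
    using D(5)[OF E(1-3)] by blast
  have "\<exists>!u. u \<in> Hom C Y Z \<and> u \<cdot>\<^bsub>C\<^esub> e = h"
    if h: "h \<in> Hom C X Z" and eq: "h \<cdot>\<^bsub>C\<^esub> p = h \<cdot>\<^bsub>C\<^esub> q" for Z h
    using E(4)[OF h] Comp_assoc[OF v(1) D(2) h] Comp_assoc[OF v(1) D(3) h] v(2,3) eq by simp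
  then show ?thesis unfolding is_coequaliser_def using D(2-4) e by blast
qed

lemma coequaliser_epi:
  assumes co: "is_coequaliser C f g e" and e: "e \<in> Hom C X Y"
    and h: "h \<in> Hom C Y Z" and k: "k \<in> Hom C Y Z" and eq: "h \<cdot>\<^bsub>C\<^esub> e = k \<cdot>\<^bsub>C\<^esub> e"
  shows "h = k"
proof -
  note E = is_coequaliserD[OF co e]
  have "(h \<cdot>\<^bsub>C\<^esub> e) \<cdot>\<^bsub>C\<^esub> f = (h \<cdot>\<^bsub>C\<^esub> e) \<cdot>\<^bsub>C\<^esub> g"
    using Comp_assoc[OF E(1) e h] Comp_assoc[OF E(2) e h] E(3) by simp
  from E(4)[OF Comp_Hom[OF e h] this] show ?thesis using h k eq by metis
qed

text \<open>With \<open>j\<close> inverse to \<open>i\<close>, arrows \<open>h\<close> and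
  \<open>k\<close> to be tested against \<open>f\<close> are replaced by \<open>j \<cdot> h\<close>
  and \<open>j \<cdot> k\<close>, tested against \<open>f \<cdot> i\<close>; the factor
  \<open>i \<cdot> j\<close> in the middle is an identity.\<close>

lemma mono_if_mono_comp_iso:
  assumes mono: "is_mono C (f \<cdot>\<^bsub>C\<^esub> i)" and iso: "is_iso C i"
    and i: "i \<in> Hom C X Y" and f: "f \<in> Hom C Y Z"
  shows "is_mono C f"
proof -
  obtain j where j: "j \<in> Hom C Y X" and ij: "i \<cdot>\<^bsub>C\<^esub> j = Ident C Y"
    using iso i unfolding is_iso_def Hom_def by auto
  have fi: "f \<cdot>\<^bsub>C\<^esub> i \<in> Hom C X Z" using Comp_Hom[OF i f] .
  have i_j: "i \<cdot>\<^bsub>C\<^esub> j \<cdot>\<^bsub>C\<^esub> h = h" if h: "h \<in> Hom C W Y" for W h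
    using Comp_assoc[OF h j i] ij Comp_Ident_left[OF h] by simp
  have "h = k"
    if h: "h \<in> Hom C W Y" and k: "k \<in> Hom C W Y" and eq: "f \<cdot>\<^bsub>C\<^esub> h = f \<cdot>\<^bsub>C\<^esub> k" for W h k
  proof -
    have jh: "j \<cdot>\<^bsub>C\<^esub> h \<in> Hom C W X" and jk: "j \<cdot>\<^bsub>C\<^esub> k \<in> Hom C W X"
      using Comp_Hom[OF h j] Comp_Hom[OF k j] .
    have "(f \<cdot>\<^bsub>C\<^esub> i) \<cdot>\<^bsub>C\<^esub> (j \<cdot>\<^bsub>C\<^esub> h) = (f \<cdot>\<^bsub>C\<^esub> i) \<cdot>\<^bsub>C\<^esub> (j \<cdot>\<^bsub>C\<^esub> k)"
      using Comp_assoc[OF jh i f] Comp_assoc[OF jk i f] i_j[OF h] i_j[OF k] eq by simp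
    then have "j \<cdot>\<^bsub>C\<^esub> h = j \<cdot>\<^bsub>C\<^esub> k" by (rule is_monoD[OF mono fi jh jk])
    then show ?thesis using i_j[OF h] i_j[OF k] by metis
  qed
  moreover have "f \<in> Arr C" "Dom C f = Y" using f unfolding Hom_def by auto
  ultimately show ?thesis unfolding is_mono_def by blast
qed

end

text \<open>Contravariance turns precomposition with \<open>f\<close> into postcomposition with
  \<open>F f\<close>, which can be cancelled; faithfulness then removes \<open>F\<close>.\<close>

lemma (in contravariant_functor) faithful_reflects_mono_to_epi:
  assumes faith: "faithful C F" and f: "f \<in> Hom C X Y" and mono: "is_mono D (amap F f)"
  shows "is_epi C f"
proof -
  have "h = k" if h: "h \<in> Hom C Y Z" and k: "k \<in> Hom C Y Z" and eq: "h \<cdot>\<^bsub>C\<^esub> f = k \<cdot>\<^bsub>C\<^esub> f" for Z h k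
  proof -
    have "amap F f \<cdot>\<^bsub>D\<^esub> amap F h = amap F f \<cdot>\<^bsub>D\<^esub> amap F k"
      using amap_Comp[OF f h] amap_Comp[OF f k] eq by simp
    then have "amap F h = amap F k"
      by (rule is_monoD[OF mono amap_Hom[OF f] amap_Hom[OF h] amap_Hom[OF k]])
    then show ?thesis using faith h k unfolding faithful_def by blast
  qed
  moreover have "f \<in> Arr C" "Cod C f = Y" using f unfolding Hom_def by auto
  ultimately show ?thesis unfolding is_epi_def by blast
qed

section \<open>Transposition across the dual adjunction\<close>

context dual_adjunction
begin

lemma transpose_Hom:
  assumes "f \<in> Hom C X (omap S Y)" "Y \<in> Obj A"
  shows "\<phi> X Y f \<in> Hom A Y (omap P X)"
  using transpose_bij[OF P.source.Hom_Obj(1)[OF assms(1)] assms(2)] assms(1)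
  by (rule bij_betwE[rule_format])

lemma transpose_inj:
  assumes "f \<in> Hom C X (omap S Y)" "g \<in> Hom C X (omap S Y)" "Y \<in> Obj A" "\<phi> X Y f = \<phi> X Y g"
  shows "f = g"
  using bij_betw_imp_inj_on[OF transpose_bij[OF P.source.Hom_Obj(1)[OF assms(1)] assms(3)]] assms
  by (auto dest: inj_onD)

lemma transpose_surj:
  assumes "a \<in> Hom A Y (omap P X)" "X \<in> Obj C"
  obtains f where "f \<in> Hom C X (omap S Y)" "\<phi> X Y f = a"
  using bij_betw_imp_surj_on[OF transpose_bij[OF assms(2) P.target.Hom_Obj(1)[OF assms(1)]]] assms(1)
  by (metis imageE)

lemma transpose_comp_right:
  assumes h: "h \<in> Hom C X' X" and f: "f \<in> Hom C X (omap S Y)" and Y: "Y \<in> Obj A"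
  shows "\<phi> X' Y (f \<cdot>\<^bsub>C\<^esub> h) = amap P h \<cdot>\<^bsub>A\<^esub> \<phi> X Y f"
proof -
  have "amap S (Ident A Y) \<cdot>\<^bsub>C\<^esub> f \<cdot>\<^bsub>C\<^esub> h = f \<cdot>\<^bsub>C\<^esub> h"
    using S.amap_Ident[OF Y] P.source.Comp_Ident_left[OF P.source.Comp_Hom[OF h f]] by simp
  then show ?thesis
    using transpose_natural[OF h P.target.Ident_Hom[OF Y] f]
      P.target.Comp_Ident_right[OF transpose_Hom[OF f Y]] by simp
qed

lemma transpose_comp_left:
  assumes a: "a \<in> Hom A Y' Y" and f: "f \<in> Hom C X (omap S Y)"
  shows "\<phi> X Y' (amap S a \<cdot>\<^bsub>C\<^esub> f) = \<phi> X Y f \<cdot>\<^bsub>A\<^esub> a"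
proof -
  have X: "X \<in> Obj C" using P.source.Hom_Obj(1)[OF f] .
  have Y: "Y \<in> Obj A" using P.target.Hom_Obj(2)[OF a] .
  have "amap P (Ident C X) \<cdot>\<^bsub>A\<^esub> \<phi> X Y f \<cdot>\<^bsub>A\<^esub> a = \<phi> X Y f \<cdot>\<^bsub>A\<^esub> a"
    using P.amap_Ident[OF X]
      P.target.Comp_Ident_left[OF P.target.Comp_Hom[OF a transpose_Hom[OF f Y]]] by simp
  then show ?thesis
    using transpose_natural[OF P.source.Ident_Hom[OF X] a f] P.source.Comp_Ident_right[OF f] by simp
qed

text \<open>The inverse in the definition of \<open>unit_C\<close> is meaningful only on the image
  of the transpose; surjectivity puts the identity of \<open>P X\<close> there.\<close>

lemma unit_C_Hom:
  assumes "X \<in> Obj C"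
  shows "unit_C C A P S \<phi> X \<in> Hom C X (omap S (omap P X))"
    and "\<phi> X (omap P X) (unit_C C A P S \<phi> X) = Ident A (omap P X)"
proof -
  have "Ident A (omap P X) \<in> \<phi> X (omap P X) ` Hom C X (omap S (omap P X))"
    using bij_betw_imp_surj_on[OF transpose_bij[OF assms P.omap_Obj[OF assms]]]
      P.target.Ident_Hom[OF P.omap_Obj[OF assms]] by simp
  then show "unit_C C A P S \<phi> X \<in> Hom C X (omap S (omap P X))"
    and "\<phi> X (omap P X) (unit_C C A P S \<phi> X) = Ident A (omap P X)"
    unfolding unit_C_def by (rule inv_into_into, rule f_inv_into_f)
qed

text \<open>Naturality takes the factor \<open>S a\<close> out of the transpose, and the unit
  transposes to an identity, so only \<open>a\<close> remains. For \<open>a\<close> the semantics,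
  this makes the theory map its transpose.\<close>

lemma transpose_amap_unit:
  assumes a: "a \<in> Hom A Y (omap P X)" and X: "X \<in> Obj C"
  shows "amap S a \<cdot>\<^bsub>C\<^esub> unit_C C A P S \<phi> X \<in> Hom C X (omap S Y)"
    and "\<phi> X Y (amap S a \<cdot>\<^bsub>C\<^esub> unit_C C A P S \<phi> X) = a"
  using P.source.Comp_Hom[OF unit_C_Hom(1)[OF X] S.amap_Hom[OF a]]
    transpose_comp_left[OF a unit_C_Hom(1)[OF X]] unit_C_Hom(2)[OF X]
    P.target.Comp_Ident_left[OF a] by simp_all

lemma amap_transpose_unit:
  assumes f: "f \<in> Hom C X (omap S Y)" and Y: "Y \<in> Obj A"
  shows "amap S (\<phi> X Y f) \<cdot>\<^bsub>C\<^esub> unit_C C A P S \<phi> X = f"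
  using transpose_amap_unit[OF transpose_Hom[OF f Y] P.source.Hom_Obj(1)[OF f]]
  by (intro transpose_inj[OF _ f Y])

section \<open>Dual spans of kernel pairs\<close>

text \<open>As half of a dual adjunction, \<open>P\<close> turns colimits into limits:
  \<open>h\<close> transposes to an arrow \<open>k\<close> out of \<open>X\<close> that identifies
  \<open>p\<close> and \<open>q\<close>, and the factorisation of \<open>k\<close> through
  \<open>e\<close> is transposed back.\<close>

lemma coequaliser_imp_equaliser:
  assumes co: "is_coequaliser C p q e" and e: "e \<in> Hom C X Z"
    and p: "p \<in> Hom C B X" and q: "q \<in> Hom C B X"
    and h: "h \<in> Hom A W (omap P X)" and eq: "amap P p \<cdot>\<^bsub>A\<^esub> h = amap P q \<cdot>\<^bsub>A\<^esub> h"
  shows "\<exists>!u. u \<in> Hom A W (omap P Z) \<and> amap P e \<cdot>\<^bsub>A\<^esub> u = h"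
proof -
  have W: "W \<in> Obj A" and X: "X \<in> Obj C" and Z: "Z \<in> Obj C"
    using P.target.Hom_Obj(1)[OF h] P.source.Hom_Obj[OF e] by auto
  obtain k where k: "k \<in> Hom C X (omap S W)" and kh: "\<phi> X W k = h"
    using transpose_surj[OF h X] .
  have kpq: "k \<cdot>\<^bsub>C\<^esub> p = k \<cdot>\<^bsub>C\<^esub> q"
    using transpose_comp_right[OF p k W] transpose_comp_right[OF q k W] kh eq
    by (intro transpose_inj[OF P.source.Comp_Hom[OF p k] P.source.Comp_Hom[OF q k] W]) simp
  obtain u where u: "u \<in> Hom C Z (omap S W)" and ue: "u \<cdot>\<^bsub>C\<^esub> e = k"
    using is_coequaliserD(4)[OF co e k kpq] by blast
  show ?thesis
  proof (intro ex1I[of _ "\<phi> Z W u"] conjI; (elim conjE)?)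
    show "\<phi> Z W u \<in> Hom A W (omap P Z)" using transpose_Hom[OF u W] .
    show "amap P e \<cdot>\<^bsub>A\<^esub> \<phi> Z W u = h" using transpose_comp_right[OF e u W] ue kh by simp
  next
    \<comment> \<open>Uniqueness is checked in \<open>C\<close>: a competing factorisation is
      transposed back to \<open>w\<close>, and the coequaliser \<open>e\<close> is cancelled
      there.\<close>
    fix v assume v: "v \<in> Hom A W (omap P Z)" and ev: "amap P e \<cdot>\<^bsub>A\<^esub> v = h"
    obtain w where w: "w \<in> Hom C Z (omap S W)" and wv: "\<phi> Z W w = v"
      using transpose_surj[OF v Z] .
    have "w \<cdot>\<^bsub>C\<^esub> e = u \<cdot>\<^bsub>C\<^esub> e"
      using transpose_comp_right[OF e w W] wv ev kh ue
      by (intro transpose_inj[OF P.source.Comp_Hom[OF e w] P.source.Comp_Hom[OF e u] W]) simp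
    then have "w = u" by (rule P.source.coequaliser_epi[OF co e w u])
    then show "v = \<phi> Z W u" using wv by simp
  qed
qed

lemma dual_span_of_kernel_pair:
  assumes kp: "is_kernel_pair C e B p q" and re: "is_regular_epi C e" and e: "e \<in> Hom C X Z"
  shows "is_dual_span A P p q (omap P Z) (amap P e) (amap P e)"
proof -
  note D = is_pullbackD[OF kp[unfolded is_kernel_pair_def] e e]
  have co: "is_coequaliser C p q e"
    using P.source.regular_epi_coequaliser_of_kernel_pair[OF re e kp] .
  obtain s where s: "s \<in> Hom C X B" and ps: "p \<cdot>\<^bsub>C\<^esub> s = Ident C X" and qs: "q \<cdot>\<^bsub>C\<^esub> s = Ident C X"
    using P.source.kernel_pair_section[OF kp e] .
  \<comment> \<open>The diagonal \<open>s\<close> is a section of both projections, so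
    \<open>P s\<close> is a common left inverse of \<open>P p\<close> and
    \<open>P q\<close>.\<close>
  have retract: "amap P s \<cdot>\<^bsub>A\<^esub> amap P r \<cdot>\<^bsub>A\<^esub> h = h"
    if r: "r \<in> Hom C B X" and rs: "r \<cdot>\<^bsub>C\<^esub> s = Ident C X" and h: "h \<in> Hom A W (omap P X)" for r h W
    using P.target.Comp_assoc[OF h P.amap_Hom[OF r] P.amap_Hom[OF s]] P.amap_Comp[OF s r] rs
      P.amap_Ident[OF P.source.Hom_Obj(1)[OF e]] P.target.Comp_Ident_left[OF h] by simp
  have "\<exists>!u. u \<in> Hom A W (omap P Z) \<and> amap P e \<cdot>\<^bsub>A\<^esub> u = h \<and> amap P e \<cdot>\<^bsub>A\<^esub> u = k"
    if h: "h \<in> Hom A W (omap P X)" and k: "k \<in> Hom A W (omap P X)"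
      and eq: "amap P p \<cdot>\<^bsub>A\<^esub> h = amap P q \<cdot>\<^bsub>A\<^esub> k" for W h k
  proof -
    \<comment> \<open>Applying \<open>P s\<close> to both sides of \<open>eq\<close> collapses every
      cone to a single arrow, which reduces the pullback property to that of the equaliser.\<close>
    have "h = k" using retract[OF D(2) ps h] retract[OF D(3) qs k] eq by simp
    then show ?thesis using coequaliser_imp_equaliser[OF co e D(2,3) h] eq by simp
  qed
  moreover have "amap P p \<cdot>\<^bsub>A\<^esub> amap P e = amap P q \<cdot>\<^bsub>A\<^esub> amap P e"
    using P.amap_Comp[OF D(2) e] P.amap_Comp[OF D(3) e] D(4) by simp
  moreover have "omap P Z \<in> Obj A" using P.omap_Obj[OF P.source.Hom_Obj(2)[OF e]] .
  ultimately show ?thesis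
    unfolding is_dual_span_def is_pullback_def using P.amap_Hom[OF e] P.amap_Hom[OF D(2)] P.amap_Hom[OF D(3)]
    by blast
qed

lemma Obj_fixed_C: "X \<in> Obj (fixed_C C A P S \<phi>) \<longleftrightarrow> X \<in> Obj C \<and> is_iso C (unit_C C A P S \<phi> X)"
  unfolding fixed_C_def full_subcategory_def by simp

text \<open>Precomposing \<open>S\<close> of the transpose with the unit at \<open>Z\<close> gives
  back \<open>m\<close>. This unit is invertible because \<open>Z\<close> is a fixed object, so
  \<open>S\<close> of the transpose is itself a monomorphism.\<close>

lemma transpose_of_mono_epi:
  assumes m: "m \<in> Hom C Z (omap S Y)" and mono: "is_mono C m" and Y: "Y \<in> Obj A"
    and Z: "Z \<in> Obj (fixed_C C A P S \<phi>)" and faith: "faithful A S"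
  shows "is_epi A (\<phi> Z Y m)"
proof -
  have iso: "is_iso C (unit_C C A P S \<phi> Z)" and ZC: "Z \<in> Obj C" using Z Obj_fixed_C by auto
  have n: "\<phi> Z Y m \<in> Hom A Y (omap P Z)" using transpose_Hom[OF m Y] .
  have "is_mono C (amap S (\<phi> Z Y m))"
    using P.source.mono_if_mono_comp_iso[OF _ iso unit_C_Hom(1)[OF ZC] S.amap_Hom[OF n]]
      amap_transpose_unit[OF m Y] mono by simp
  then show ?thesis by (rule S.faithful_reflects_mono_to_epi[OF faith n])
qed

end

section \<open>Semantics of coalgebras and the bisimulation equation\<close>

context coalgebraic_logic
begin

lemma complex_algebra_Hom:
  assumes "is_coalgebra C T X \<gamma>"
  shows "complex_algebra A P \<rho> X \<gamma> \<in> Hom A (omap L (omap P X)) (omap P X)"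
  using assms P.target.Comp_Hom[OF rho_Hom P.amap_Hom]
  unfolding is_coalgebra_def complex_algebra_def by blast

text \<open>Initiality supplies the unique existence that gives the definite description in
  \<open>semantics\<close> its meaning.\<close>

lemma semantics_algebra_morphism:
  assumes "is_initial_algebra A L \<Phi> \<alpha>" "is_coalgebra C T X \<gamma>"
  shows "is_algebra_morphism A L \<Phi> \<alpha> (omap P X) (complex_algebra A P \<rho> X \<gamma>)
    (semantics A P L \<rho> \<Phi> \<alpha> X \<gamma>)"
proof -
  have "is_algebra A L (omap P X) (complex_algebra A P \<rho> X \<gamma>)"
    using complex_algebra_Hom[OF assms(2)] assms(2) P.omap_Obj
    unfolding is_algebra_def is_coalgebra_def by blast
  then show ?thesis
    unfolding semantics_def using assms(1) unfolding is_initial_algebra_def by (blast intro: theI')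
qed

text \<open>
  There need not be a coalgebra structure on \<open>Z\<close> making \<open>e\<close> a morphism; only the factorisation of
  the semantics \<open>s\<close> through \<open>P e\<close> is used.
\<close>

lemma kernel_pair_rho_bisimulation:
  assumes kp: "is_kernel_pair C e B p q" and re: "is_regular_epi C e" and e: "e \<in> Hom C X Z"
    and coalg: "is_coalgebra C T X \<gamma>"
    and mor: "is_algebra_morphism A L \<Phi> \<alpha> (omap P X) (complex_algebra A P \<rho> X \<gamma>) s"
    and alg: "is_algebra A L \<Phi> \<alpha>"
    and n: "n \<in> Hom A \<Phi> (omap P Z)" and s: "s = amap P e \<cdot>\<^bsub>A\<^esub> n"
    and epi: "is_epi A (amap L n)"
  shows "is_rho_bisimulation C A P L \<rho> X \<gamma> X \<gamma> B p q"
proof -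
  let ?c = "complex_algebra A P \<rho> X \<gamma>"
  note D = is_pullbackD[OF kp[unfolded is_kernel_pair_def] e e]
  note c = complex_algebra_Hom[OF coalg]
  note Pe = P.amap_Hom[OF e] and Pp = P.amap_Hom[OF D(2)] and Pq = P.amap_Hom[OF D(3)]
  note LPe = L.amap_Hom[OF Pe] and Ln = L.amap_Hom[OF n]
  note cLPe = P.target.Comp_Hom[OF LPe c]
  have \<alpha>: "\<alpha> \<in> Hom A (omap L \<Phi>) \<Phi>" using alg unfolding is_algebra_def by blast
  have s_hom: "s \<in> Hom A \<Phi> (omap P X)" and s\<alpha>: "s \<cdot>\<^bsub>A\<^esub> \<alpha> = ?c \<cdot>\<^bsub>A\<^esub> amap L s"
    using mor unfolding is_algebra_morphism_def by auto
  \<comment> \<open>The right-hand side depends on \<open>r\<close> only through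
    \<open>e \<cdot> r\<close>, which is the same arrow for \<open>r = p\<close> and
    \<open>r = q\<close>. The semantics being an algebra morphism is what moves \<open>e\<close>
    next to \<open>r\<close>.\<close>
  have comp_Ln: "(amap P r \<cdot>\<^bsub>A\<^esub> ?c \<cdot>\<^bsub>A\<^esub> amap L (amap P e)) \<cdot>\<^bsub>A\<^esub> amap L n = amap P (e \<cdot>\<^bsub>C\<^esub> r) \<cdot>\<^bsub>A\<^esub> n \<cdot>\<^bsub>A\<^esub> \<alpha>"
    if r: "r \<in> Hom C B X" for r
  proof -
    note Pr = P.amap_Hom[OF r]
    have "(amap P r \<cdot>\<^bsub>A\<^esub> ?c \<cdot>\<^bsub>A\<^esub> amap L (amap P e)) \<cdot>\<^bsub>A\<^esub> amap L n = amap P r \<cdot>\<^bsub>A\<^esub> ?c \<cdot>\<^bsub>A\<^esub> amap L s"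
      using P.target.Comp_assoc[OF Ln cLPe Pr] P.target.Comp_assoc[OF Ln LPe c] L.amap_Comp[OF n Pe] s
      by simp
    also have "\<dots> = amap P r \<cdot>\<^bsub>A\<^esub> (amap P e \<cdot>\<^bsub>A\<^esub> n) \<cdot>\<^bsub>A\<^esub> \<alpha>"
      using s\<alpha> s by simp
    also have "\<dots> = amap P (e \<cdot>\<^bsub>C\<^esub> r) \<cdot>\<^bsub>A\<^esub> n \<cdot>\<^bsub>A\<^esub> \<alpha>"
      using P.target.Comp_assoc[OF \<alpha> n Pe] P.target.Comp_assoc[OF P.target.Comp_Hom[OF \<alpha> n] Pe Pr]
        P.amap_Comp[OF r e] by simp
    finally show ?thesis .
  qed
  have "amap P p \<cdot>\<^bsub>A\<^esub> ?c \<cdot>\<^bsub>A\<^esub> amap L (amap P e) = amap P q \<cdot>\<^bsub>A\<^esub> ?c \<cdot>\<^bsub>A\<^esub> amap L (amap P e)"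
    using comp_Ln[OF D(2)] comp_Ln[OF D(3)] D(4)
    by (intro is_epiD[OF epi Ln P.target.Comp_Hom[OF cLPe Pp] P.target.Comp_Hom[OF cLPe Pq]]) simp
  then show ?thesis
    unfolding is_rho_bisimulation_def
    using D(1-3) P.source.pullback_jointly_mono[OF kp[unfolded is_kernel_pair_def] e e]
      dual_span_of_kernel_pair[OF kp re e] by blast
qed

end

section \<open>Factorisation of the theory map and its transpose\<close>

theorem theorem4p4:
  fixes C :: "('co, 'cm) category" and A :: "('ao, 'am) category"
    and P :: "('co, 'cm, 'ao, 'am) functor_data"
    and S :: "('ao, 'am, 'co, 'cm) functor_data"
    and \<phi> :: "'co \<Rightarrow> 'ao \<Rightarrow> 'cm \<Rightarrow> 'am"
    and T :: "('co, 'cm, 'co, 'cm) functor_data"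
    and L :: "('ao, 'am, 'ao, 'am) functor_data"
    and \<rho> :: "'co \<Rightarrow> 'am"
    and \<Phi> :: 'ao and \<alpha> :: 'am
  assumes "coalgebraic_logic C A P S \<phi> T L \<rho>"
    and "is_initial_algebra A L \<Phi> \<alpha>"
    and "has_pullbacks C"
    and "has_pullbacks A \<or> has_pushouts C"
    and "has_RegEpi_Mono_factorisations_from C (Obj (fixed_C C A P S \<phi>))"
    and "closed_under_regular_epi_images C (Obj (fixed_C C A P S \<phi>))"
    and "faithful A S"
    and "preserves_epis A A L"
  shows "\<forall>X \<gamma> B \<pi> \<pi>'.
    is_coalgebra C T X \<gamma> \<longrightarrow> X \<in> Obj (fixed_C C A P S \<phi>) \<longrightarrow>
    is_kernel_pair C (theory_map C A P S \<phi> L \<rho> \<Phi> \<alpha> X \<gamma>) B \<pi> \<pi>' \<longrightarrow>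
    is_rho_bisimulation C A P L \<rho> X \<gamma> X \<gamma> B \<pi> \<pi>'"
proof (intro allI impI)
  interpret coalgebraic_logic C A P S \<phi> T L \<rho> by fact
  fix X \<gamma> B \<pi> \<pi>'
  assume coalg: "is_coalgebra C T X \<gamma>" and X: "X \<in> Obj (fixed_C C A P S \<phi>)"
    and kp: "is_kernel_pair C (theory_map C A P S \<phi> L \<rho> \<Phi> \<alpha> X \<gamma>) B \<pi> \<pi>'"
  let ?s = "semantics A P L \<rho> \<Phi> \<alpha> X \<gamma>" and ?th = "theory_map C A P S \<phi> L \<rho> \<Phi> \<alpha> X \<gamma>"
  have alg: "is_algebra A L \<Phi> \<alpha>" and \<Phi>: "\<Phi> \<in> Obj A"
    using assms(2) unfolding is_initial_algebra_def is_algebra_def by auto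
  have mor: "is_algebra_morphism A L \<Phi> \<alpha> (omap P X) (complex_algebra A P \<rho> X \<gamma>) ?s"
    using semantics_algebra_morphism[OF assms(2) coalg] .
  then have s: "?s \<in> Hom A \<Phi> (omap P X)" unfolding is_algebra_morphism_def by blast
  have XC: "X \<in> Obj C" using X Obj_fixed_C by blast
  have th: "?th \<in> Hom C X (omap S \<Phi>)" and th_s: "\<phi> X \<Phi> ?th = ?s"
    using transpose_amap_unit[OF s XC] unfolding theory_map_def .
  obtain Z e m where e: "e \<in> Hom C X Z" and m: "m \<in> Hom C Z (omap S \<Phi>)"
    and re: "is_regular_epi C e" and mono: "is_mono C m" and fact: "?th = m \<cdot>\<^bsub>C\<^esub> e"
    using assms(5) X th unfolding has_RegEpi_Mono_factorisations_from_def by blast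
  \<comment> \<open>The image \<open>Z\<close> must again be a fixed object: invertibility of its
    unit is what makes the transpose of \<open>m\<close> an epimorphism.\<close>
  have Z: "Z \<in> Obj (fixed_C C A P S \<phi>)"
    using assms(6) X e re unfolding closed_under_regular_epi_images_def by blast
  have "is_kernel_pair C e B \<pi> \<pi>'"
    using P.source.kernel_pair_mono_comp[OF kp[unfolded fact] e m mono] .
  \<comment> \<open>Transposing \<open>?th = m \<cdot> e\<close> reverses the factors: the semantics
    factors through \<open>P e\<close> by the transpose of \<open>m\<close>.\<close>
  moreover have "?s = amap P e \<cdot>\<^bsub>A\<^esub> \<phi> Z \<Phi> m"
    using transpose_comp_right[OF e m \<Phi>] th_s fact by simp
  moreover have "is_epi A (amap L (\<phi> Z \<Phi> m))"
    using transpose_of_mono_epi[OF m mono \<Phi> Z assms(7)] assms(8) unfolding preserves_epis_def by blast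
  ultimately show "is_rho_bisimulation C A P L \<rho> X \<gamma> X \<gamma> B \<pi> \<pi>'"
    using kernel_pair_rho_bisimulation[OF _ re e coalg mor alg transpose_Hom[OF m \<Phi>]] by blast
qed

end
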